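(* Given $\lambda, m, n\in\mathbb{N}$, $\widetilde{\chi}(\lambda K_{n,m})=2$.
   Context: $\mathbb{N}$ denotes the positive integers. A multigraph $G=(V,E)$ is finite and without loops; parallel edges are allowed. For $x\in V$, $E(x)$ denotes the set of edges of $G$ incident to $x$ (parallel edges counted separately). $\lambda K_{n,m}$ is the complete bipartite multigraph with parts of sizes $n$ and $m$ in which every vertex of one part is joined to every vertex of the other part by exactly $\lambda$ parallel edges, and there are no other edges. For an integer $k\ge 2$, a $k$-homogeneous edge-coloring of $G$ is a map $c\colon E\to S$, where $S$ is a set of colors with $|S|=k$ ($c$ is not required to be surjective or proper), such that for every $x\in V$, writing $|E(x)|=k q_x+r_x$ with $0\le r_x<k$, exactly $r_x$ of the colors in $S$ are each assigned to exactly $q_x+1$ edges of $E(x)$, and each of the other $k-r_x$ colors is assigned to exactly $q_x$ edges of $E(x)$. (In particular, if $|E(x)|<k$, the edges of $E(x)$ have pairwise different colors.) The homogeneous chromatic index $\widetilde{\chi}(G)$ is the minimum integer $k\ge 2$ such that $G$ admits a $k$-homogeneous edge-coloring. *)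

theory Defs
  imports Main
begin

record ('v, 'e) multigraph =
  verts :: "'v set"
  edges :: "'e set"
  ends :: "'e \<Rightarrow> 'v set"

text \<open>Edges are objects of their own, so parallel edges are distinct edges with the same
  set of ends. Loops are excluded because every edge has two distinct ends.\<close>

locale multigraph =
  fixes G :: "('v, 'e) multigraph"
  assumes finite_verts: "finite (verts G)"
    and finite_edges: "finite (edges G)"
    and ends_subset: "e \<in> edges G \<Longrightarrow> ends G e \<subseteq> verts G"
    and card_ends: "e \<in> edges G \<Longrightarrow> card (ends G e) = 2"

definition incident_edges :: "('v, 'e) multigraph \<Rightarrow> 'v \<Rightarrow> 'e set" where
  "incident_edges G x = {e \<in> edges G. x \<in> ends G e}"

definition color_count :: "('v, 'e) multigraph \<Rightarrow> ('e \<Rightarrow> 'c) \<Rightarrow> 'v \<Rightarrow> 'c \<Rightarrow> nat" where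
  "color_count G c x s = card {e \<in> incident_edges G x. c e = s}"

definition homogeneous_edge_coloring ::
  "nat \<Rightarrow> ('v, 'e) multigraph \<Rightarrow> 'c set \<Rightarrow> ('e \<Rightarrow> 'c) \<Rightarrow> bool" where
  "homogeneous_edge_coloring k G S c \<longleftrightarrow>
     k \<ge> 2 \<and> card S = k \<and> c ` edges G \<subseteq> S \<and>
     (\<forall>x \<in> verts G.
        let q = card (incident_edges G x) div k;
            r = card (incident_edges G x) mod k
        in card {s \<in> S. color_count G c x s = q + 1} = r \<and>
           (\<forall>s \<in> S. color_count G c x s \<noteq> q + 1 \<longrightarrow> color_count G c x s = q))"

text \<open>Natural numbers serve as colors; this loses nothing, since the set of colors is finite.\<close>

definition homogeneously_colorable :: "nat \<Rightarrow> ('v, 'e) multigraph \<Rightarrow> bool" where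
  "homogeneously_colorable k G \<longleftrightarrow>
     (\<exists>(S :: nat set) c. homogeneous_edge_coloring k G S c)"

definition homogeneous_chromatic_index :: "('v, 'e) multigraph \<Rightarrow> nat" where
  "homogeneous_chromatic_index G = (LEAST k. k \<ge> 2 \<and> homogeneously_colorable k G)"

text \<open>The minimum is over a nonempty set: coloring the edges injectively works as soon as
  there are more colors than edges.\<close>

lemma (in multigraph) ex_homogeneously_colorable: "\<exists>k \<ge> 2. homogeneously_colorable k G"
proof -
  define k where "k = card (edges G) + 2"
  obtain c where c: "inj_on c (edges G)" "c ` edges G \<subseteq> {..<k}"
    using finite_edges card_le_inj[of "edges G" "{..<k}"] by (auto simp: k_def)
  have "homogeneous_edge_coloring k G {..<k} c"
    unfolding homogeneous_edge_coloring_def Let_def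
  proof (intro conjI ballI impI)
    fix x
    let ?I = "incident_edges G x"
    have sub: "?I \<subseteq> edges G" by (auto simp: incident_edges_def)
    have inj: "inj_on c ?I" using c(1) sub by (rule inj_on_subset)
    have "card ?I < k" using card_mono[OF finite_edges sub] by (simp add: k_def)
    then have q: "card ?I div k = 0" and r: "card ?I mod k = card ?I" by simp_all
    have count: "color_count G c x s = (if s \<in> c ` ?I then 1 else 0)" for s
    proof (cases "s \<in> c ` ?I")
      case True
      then obtain e where "e \<in> ?I" "c e = s" by auto
      then have "{e \<in> ?I. c e = s} = {e}" using inj by (auto dest: inj_onD)
      then show ?thesis using True by (simp add: color_count_def)
    next
      case False
      then have "{e \<in> ?I. c e = s} = {}" by auto
      then show ?thesis using False by (simp only: color_count_def card.empty if_False)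
    qed
    have "{s \<in> {..<k}. color_count G c x s = card ?I div k + 1} = c ` ?I"
      using c(2) sub by (auto simp: count q)
    then show "card {s \<in> {..<k}. color_count G c x s = card ?I div k + 1} = card ?I mod k"
      by (simp add: r card_image inj)
    show "color_count G c x s = card ?I div k"
      if "color_count G c x s \<noteq> card ?I div k + 1" for s
      using that by (simp add: count q split: if_splits)
  qed (use c(2) in \<open>simp_all add: k_def\<close>)
  then show ?thesis
    by (intro exI[of _ k]) (auto simp: homogeneously_colorable_def k_def)
qed

text \<open>\<open>complete_bipartite_multigraph l n m\<close> is \<open>\<lambda>K\<^sub>n\<^sub>,\<^sub>m\<close> with \<open>\<lambda> = l\<close>: its parts are
  tagged copies of \<open>{..<n}\<close> and \<open>{..<m}\<close>, and \<open>(i, j, t)\<close> is the \<open>t\<close>-th of the \<open>l\<close> parallel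
  edges that join \<open>Inl i\<close> and \<open>Inr j\<close>.\<close>

definition complete_bipartite_multigraph ::
  "nat \<Rightarrow> nat \<Rightarrow> nat \<Rightarrow> (nat + nat, nat \<times> nat \<times> nat) multigraph" where
  "complete_bipartite_multigraph l n m =
     \<lparr>verts = {..<n} <+> {..<m},
      edges = {..<n} \<times> {..<m} \<times> {..<l},
      ends = (\<lambda>(i, j, t). {Inl i, Inr j})\<rparr>"

lemma multigraph_complete_bipartite: "multigraph (complete_bipartite_multigraph l n m)"
  by unfold_locales (auto simp: complete_bipartite_multigraph_def)

end

theory Submission
  imports Defs
begin

text \<open>Color the edge \<open>(i, j, t)\<close> by the parity of \<open>i + j + t\<close>. The edges at a vertex form a box
  with one side a single point and the others initial segments, so the difference between
  the two color counts is, up to sign, a product of alternating sums \<open>1 - 1 + 1 - \<dots>\<close>, and hence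
  \<open>-1\<close>, \<open>0\<close> or \<open>1\<close>.\<close>

lemma sum_minus_one_power_eq_card_diff:
  fixes f :: "'a \<Rightarrow> nat"
  assumes "finite A"
  shows "(\<Sum>e\<in>A. (-1) ^ f e :: int) =
    int (card {e \<in> A. f e mod 2 = 0}) - int (card {e \<in> A. f e mod 2 = 1})"
proof -
  have "(-1) ^ f e = (of_bool (f e mod 2 = 0) - of_bool (f e mod 2 = 1) :: int)" for e
    by (cases "even (f e)") (auto simp: even_iff_mod_2_eq_zero odd_iff_mod_2_eq_one)
  then show ?thesis
    using assms by (simp add: sum_subtractf of_bool_def sum.If_cases Int_def)
qed

text \<open>The signed sum at \<open>x\<close> is the difference of the two color counts, and their
  total is the degree. Two naturals with a given total that differ by at most 1 are the two halves
  of that total, rounded down and up, which is homogeneity for two colors.\<close>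

lemma homogeneous_edge_coloring_parity:
  fixes f :: "'e \<Rightarrow> nat"
  assumes fin: "finite (edges G)"
    and bal: "\<And>x. x \<in> verts G \<Longrightarrow> \<bar>\<Sum>e\<in>incident_edges G x. (-1) ^ f e :: int\<bar> \<le> 1"
  shows "homogeneous_edge_coloring 2 G {0, 1 :: nat} (\<lambda>e. f e mod 2)"
  unfolding homogeneous_edge_coloring_def Let_def
proof (intro conjI)
  \<comment> \<open>Deciding \<open>P\<close> at each color separately lets the simplifier compute
    the cardinality in every case below.\<close>
  have colors: "{s \<in> {0, 1}. P s} = (if P 0 then {0} else {}) \<union> (if P 1 then {1} else {})"
    for P :: "nat \<Rightarrow> bool"
    by (auto intro!: gr0I)
  let ?I = "incident_edges G"
  let ?a = "color_count G (\<lambda>e. f e mod 2)"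
  show "\<forall>x\<in>verts G. card {s \<in> {0, 1}. ?a x s = card (?I x) div 2 + 1} = card (?I x) mod 2 \<and>
    (\<forall>s\<in>{0, 1}. ?a x s \<noteq> card (?I x) div 2 + 1 \<longrightarrow> ?a x s = card (?I x) div 2)"
    (is "\<forall>x\<in>_. ?P x")
  proof
    fix x assume x: "x \<in> verts G"
    have fin_I: "finite (?I x)"
      using fin by (simp add: incident_edges_def)
    have "?I x = {e \<in> ?I x. f e mod 2 = 0} \<union> {e \<in> ?I x. f e mod 2 = 1}"
      by auto
    also have "card \<dots> = ?a x 0 + ?a x 1"
      unfolding color_count_def using fin_I by (intro card_Un_disjoint) auto
    finally have total: "card (?I x) = ?a x 0 + ?a x 1" .
    have "\<bar>int (?a x 0) - int (?a x 1)\<bar> \<le> 1"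
      using bal[OF x] sum_minus_one_power_eq_card_diff[OF fin_I, of f]
      by (simp add: color_count_def)
    \<comment> \<open>Equal counts mean even degree and remainder 0; otherwise the degree is odd and
      only the color ahead by one attains \<open>q + 1\<close>.\<close>
    then consider "?a x 0 = ?a x 1" | "?a x 0 = ?a x 1 + 1" | "?a x 1 = ?a x 0 + 1"
      by linarith
    then show "?P x"
    proof cases
      case 1
      then have "card (?I x) = 2 * ?a x 1" by (simp add: total)
      with 1 show ?thesis unfolding colors by simp
    next
      case 2
      then have "card (?I x) = 2 * ?a x 1 + 1" by (simp add: total)
      with 2 show ?thesis unfolding colors by simp
    next
      case 3
      then have "card (?I x) = 2 * ?a x 0 + 1" by (simp add: total)
      with 3 show ?thesis unfolding colors by simp
    qed
  qed
qed auto

lemma alternating_sum_lessThan: "(\<Sum>i<n. (-1) ^ i :: int) = of_bool (odd n)"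
  by (induction n) auto

text \<open>The sign of \<open>i + j + t\<close> is the product of the signs of the coordinates, so
  the sum over a box factors.\<close>

lemma sum_minus_one_power_box:
  "(\<Sum>(i, j, t)\<in>A \<times> B \<times> C. (-1) ^ (i + j + t) :: int) =
    (\<Sum>i\<in>A. (-1) ^ i) * (\<Sum>j\<in>B. (-1) ^ j) * (\<Sum>t\<in>C. (-1) ^ t)"
  by (simp add: sum.cartesian_product[symmetric] power_add
      sum_distrib_left[symmetric] sum_distrib_right[symmetric] mult.assoc)

lemma homogeneously_colorable_complete_bipartite:
  "homogeneously_colorable 2 (complete_bipartite_multigraph l n m)"
proof -
  let ?G = "complete_bipartite_multigraph l n m"
  let ?f = "\<lambda>(i, j, t). i + j + t :: nat"
  have "\<bar>\<Sum>e\<in>incident_edges ?G x. (-1) ^ ?f e :: int\<bar> \<le> 1" if "x \<in> verts ?G" for x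
  proof -
    \<comment> \<open>A common box form for both parts of the graph: the side fixed by
      \<open>x\<close> is a singleton with sum 1 or -1, and the other two are initial segments with
      sum 0 or 1.\<close>
    obtain A B C where I: "incident_edges ?G x = A \<times> B \<times> C"
      and le: "\<bar>\<Sum>i\<in>A. (-1) ^ i :: int\<bar> \<le> 1" "\<bar>\<Sum>j\<in>B. (-1) ^ j :: int\<bar> \<le> 1"
        "\<bar>\<Sum>t\<in>C. (-1) ^ t :: int\<bar> \<le> 1"
    proof (cases x)
      case (Inl i)
      then have "incident_edges ?G x = {i} \<times> {..<m} \<times> {..<l}"
        using \<open>x \<in> verts ?G\<close> by (auto simp: incident_edges_def complete_bipartite_multigraph_def)
      then show ?thesis
        by (rule that) (simp_all add: alternating_sum_lessThan power_abs)
    next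
      case (Inr j)
      then have "incident_edges ?G x = {..<n} \<times> {j} \<times> {..<l}"
        using \<open>x \<in> verts ?G\<close> by (auto simp: incident_edges_def complete_bipartite_multigraph_def)
      then show ?thesis
        by (rule that) (simp_all add: alternating_sum_lessThan power_abs)
    qed
    have "(\<Sum>e\<in>incident_edges ?G x. (-1) ^ ?f e :: int) =
      (\<Sum>i\<in>A. (-1) ^ i) * (\<Sum>j\<in>B. (-1) ^ j) * (\<Sum>t\<in>C. (-1) ^ t)"
      unfolding I sum_minus_one_power_box[symmetric] by (intro sum.cong) auto
    then show ?thesis
      using le by (simp add: abs_mult mult_le_one)
  qed
  moreover have "finite (edges ?G)"
    by (simp add: complete_bipartite_multigraph_def)
  ultimately have "homogeneous_edge_coloring 2 ?G {0, 1 :: nat} (\<lambda>e. ?f e mod 2)"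
    by (intro homogeneous_edge_coloring_parity)
  then show ?thesis
    unfolding homogeneously_colorable_def by (intro exI)
qed

theorem theorem4p3:
  fixes l m n :: nat
  assumes "l \<ge> 1" and "m \<ge> 1" and "n \<ge> 1"
  shows "homogeneous_chromatic_index (complete_bipartite_multigraph l n m) = 2"
  unfolding homogeneous_chromatic_index_def
  \<comment> \<open>Minimality is immediate, since the index ranges only over
    \<open>k \<ge> 2\<close>.\<close>
  using homogeneously_colorable_complete_bipartite by (intro Least_equality) auto

end
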